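(* Let $A\in\mathbb{R}^{m\times n}$ and let $M\in\mathbb{R}^{n\times n}$ be symmetric positive definite. Then there exist a 2-orthogonal matrix $U\in\mathbb{R}^{m\times m}$, an $M$-orthogonal matrix $V\in\mathbb{R}^{n\times n}$, and a diagonal matrix $\Sigma_r=\mathrm{diag}(\sigma_1,\dots,\sigma_r)$ with $\sigma_1\geq\dots\geq\sigma_r>0$, such that $$U^{\top}AV=\Sigma:=\begin{pmatrix}\Sigma_r & \mathbf{0}\\ \mathbf{0} & \mathbf{0}\end{pmatrix},\qquad \Sigma\in\mathbb{R}^{m\times n}.$$
   Context: A matrix $U\in\mathbb{R}^{m\times m}$ is called 2-orthogonal if $U^{\top}U=I_m$. For a symmetric positive definite $M\in\mathbb{R}^{n\times n}$, a matrix $V\in\mathbb{R}^{n\times n}$ is called $M$-orthogonal if $V^{\top}MV=I_n$. Here $I_k$ is the $k\times k$ identity matrix and $\mathbf{0}$ denotes zero blocks of appropriate size (possibly empty). *)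

theory Defs
  imports Complex_Main "Jordan_Normal_Form.Matrix"
begin

definition sym_pos_def :: "nat \<Rightarrow> real mat \<Rightarrow> bool" where
  "sym_pos_def n M \<longleftrightarrow> M \<in> carrier_mat n n \<and> transpose_mat M = M \<and>
     (\<forall>x \<in> carrier_vec n. x \<noteq> 0\<^sub>v n \<longrightarrow> x \<bullet> (M *\<^sub>v x) > 0)"

(* The library predicate orthogonal_mat only requires U^T U to be diagonal with nonzero
   diagonal entries, hence the separate notion. *)
definition two_orthogonal :: "nat \<Rightarrow> real mat \<Rightarrow> bool" where
  "two_orthogonal m U \<longleftrightarrow> U \<in> carrier_mat m m \<and> transpose_mat U * U = 1\<^sub>m m"

definition M_orthogonal :: "nat \<Rightarrow> real mat \<Rightarrow> real mat \<Rightarrow> bool" where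
  "M_orthogonal n M V \<longleftrightarrow> V \<in> carrier_mat n n \<and> transpose_mat V * M * V = 1\<^sub>m n"

end

theory Submission
  imports Defs "HOL-Analysis.Function_Topology" "Jordan_Normal_Form.Determinant"
begin

text \<open>Choose \<open>v\<^sub>0, v\<^sub>1, \<dots>, v\<^sub>n\<^sub>-\<^sub>1\<close> greedily: \<open>v\<^sub>i\<close> maximises \<open>|A x|^2\<close> under \<open>x\<^sup>T M x = 1\<close> among the \<open>x\<close>
  that are \<open>M\<close>-orthogonal to the earlier vectors. The values \<open>\<sigma>\<^sub>i = |A v\<^sub>i|\<close> are then decreasing, and
  for \<open>i < j\<close> the maximality of \<open>v\<^sub>i\<close> against \<open>v\<^sub>i + t v\<^sub>j\<close> for all \<open>t\<close> forces \<open>A v\<^sub>i\<close> and \<open>A v\<^sub>j\<close> to be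
  orthogonal. Complete the unit vectors \<open>A v\<^sub>i / \<sigma>\<^sub>i\<close> with \<open>\<sigma>\<^sub>i > 0\<close> to an orthonormal basis to obtain \<open>U\<close>.\<close>

section \<open>Orthogonal complements and completion of orthonormal families\<close>

text \<open>The vectors \<open>w l\<close> become the first rows of a square matrix \<open>P\<close>
  padded with zero rows. As k < n, the last row is zero, so the transpose of \<open>P\<close> kills
  the last unit vector; hence det P = 0 and \<open>P\<close> itself has a nonzero kernel
  vector.\<close>

lemma exists_nonzero_orthogonal_vec:
  fixes w :: "nat \<Rightarrow> 'a :: field vec"
  assumes w: "\<And>l. l < k \<Longrightarrow> w l \<in> carrier_vec n" and "k < n"
  obtains x where "x \<in> carrier_vec n" "x \<noteq> 0\<^sub>v n" "\<And>l. l < k \<Longrightarrow> w l \<bullet> x = 0"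
proof -
  define P where "P = mat n n (\<lambda>(l, i). if l < k then w l $ i else 0)"
  have P: "P \<in> carrier_mat n n" by (simp add: P_def)
  have "transpose_mat P *\<^sub>v unit_vec n (n - 1) = 0\<^sub>v n"
    using \<open>k < n\<close> by (intro eq_vecI) (auto simp: P_def)
  moreover have "unit_vec n (n - 1) \<noteq> (0\<^sub>v n :: 'a vec)"
    using \<open>k < n\<close> by (metis diff_less gr_implies_not_zero index_unit_vec(1) index_zero_vec(1) less_one
      neq0_conv zero_neq_one)
  ultimately have "det (transpose_mat P) = 0"
    using P det_0_iff_vec_prod_zero[of "transpose_mat P" n] by (metis transpose_carrier_mat unit_vec_carrier)
  then obtain x where x: "x \<in> carrier_vec n" "x \<noteq> 0\<^sub>v n" "P *\<^sub>v x = 0\<^sub>v n"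
    using P det_transpose[OF P] det_0_iff_vec_prod_zero[OF P] by auto
  have "w l \<bullet> x = 0" if "l < k" for l
  proof -
    have "row P l = w l" using that \<open>k < n\<close> w[OF that] by (intro eq_vecI) (auto simp: P_def)
    then have "w l \<bullet> x = (P *\<^sub>v x) $ l" using that \<open>k < n\<close> P by simp
    then show ?thesis using x that \<open>k < n\<close> by simp
  qed
  with x show ?thesis using that by blast
qed

text \<open>If m < r, some nonzero \<open>x\<close> in dimension r is orthogonal to the m coordinate
  rows of the family, which is a linear relation between the \<open>u i\<close> with coefficients
  \<open>x $ i\<close>. Pairing the relation with \<open>u l\<close> isolates \<open>x $ l\<close>,
  so \<open>x\<close> vanishes.\<close>

lemma orthonormal_family_le_dim:
  fixes u :: "nat \<Rightarrow> real vec"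
  assumes u: "\<And>i. i < r \<Longrightarrow> u i \<in> carrier_vec m"
    and on: "\<And>i j. i < r \<Longrightarrow> j < r \<Longrightarrow> u i \<bullet> u j = (if i = j then 1 else 0)"
  shows "r \<le> m"
proof (rule ccontr)
  assume "\<not> r \<le> m"
  then have "m < r" by simp
  then obtain x where x: "x \<in> carrier_vec r" "x \<noteq> 0\<^sub>v r"
      "\<And>j. j < m \<Longrightarrow> vec r (\<lambda>i. u i $ j) \<bullet> x = 0"
    using exists_nonzero_orthogonal_vec[of m "\<lambda>j. vec r (\<lambda>i. u i $ j)" r] by auto
  have "x $ l = 0" if l: "l < r" for l
  proof -
    have "x $ l = (\<Sum>i<r. (u l \<bullet> u i) * x $ i)"
      using l by (simp add: on if_distrib[of "\<lambda>c. c * _"] cong: if_cong)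
    also have "\<dots> = (\<Sum>i<r. \<Sum>j<m. u l $ j * (u i $ j * x $ i))"
      using u by (intro sum.cong) (auto simp: scalar_prod_def sum_distrib_right atLeast0LessThan mult.assoc
        dest!: carrier_vecD)
    also have "\<dots> = (\<Sum>j<m. u l $ j * (\<Sum>i<r. u i $ j * x $ i))"
      unfolding sum_distrib_left by (rule sum.swap)
    also have "\<dots> = (\<Sum>j<m. u l $ j * (vec r (\<lambda>i. u i $ j) \<bullet> x))"
      using x(1) by (intro sum.cong) (auto simp: scalar_prod_def atLeast0LessThan)
    also have "\<dots> = 0" using x(3) by simp
    finally show ?thesis .
  qed
  then have "x = 0\<^sub>v r" using x(1) by (intro eq_vecI) auto
  with x show False by simp
qed

lemma scalar_prod_self_pos:
  fixes x :: "real vec"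
  assumes "x \<in> carrier_vec n" "x \<noteq> 0\<^sub>v n"
  shows "x \<bullet> x > 0"
proof -
  obtain i where "i < n" "x $ i \<noteq> 0" using assms by (metis carrier_vecD eq_vecI index_zero_vec)
  then show ?thesis
    using assms(1) unfolding scalar_prod_def
    by (intro sum_pos2[where i = i]) (auto simp: zero_less_mult_iff)
qed

lemma orthonormal_family_extend:
  fixes u :: "nat \<Rightarrow> real vec"
  assumes "r \<le> m"
    and "\<And>i. i < r \<Longrightarrow> u i \<in> carrier_vec m"
    and "\<And>i j. i < r \<Longrightarrow> j < r \<Longrightarrow> u i \<bullet> u j = (if i = j then 1 else 0)"
  shows "\<exists>u'. (\<forall>i<r. u' i = u i) \<and> (\<forall>i<m. u' i \<in> carrier_vec m) \<and>
    (\<forall>i<m. \<forall>j<m. u' i \<bullet> u' j = (if i = j then 1 else 0))"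
  using assms
\<comment> \<open>The induction descends from r = m, where nothing has to be added. Its hypothesis
  completes families of length \<open>Suc r\<close>, so it suffices to append one unit vector
  orthogonal to the first r; \<open>u\<close> is generalised because it becomes
  \<open>u(r := y)\<close>.\<close>
proof (induction r arbitrary: u rule: inc_induct)
  case base
  then show ?case by blast
next
  case (step r)
  from \<open>r < m\<close> step.prems(1) obtain x
    where x: "x \<in> carrier_vec m" "x \<noteq> 0\<^sub>v m" "\<And>l. l < r \<Longrightarrow> u l \<bullet> x = 0"
    using exists_nonzero_orthogonal_vec[of r u m] by auto
  define y where "y = (1 / sqrt (x \<bullet> x)) \<cdot>\<^sub>v x"
  have y: "y \<in> carrier_vec m" using x by (simp add: y_def)
  have yy: "y \<bullet> y = 1"
    using x scalar_prod_self_pos[OF x(1,2)] by (simp add: y_def field_simps)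
  have uy: "u l \<bullet> y = 0" if "l < r" for l
    using that x step.prems(1) by (auto simp: y_def)
  have yu: "y \<bullet> u l = 0" if "l < r" for l
    using uy[OF that] comm_scalar_prod[OF y step.prems(1)[OF that]] by simp
  have "\<exists>u'. (\<forall>i<Suc r. u' i = (u(r := y)) i) \<and> (\<forall>i<m. u' i \<in> carrier_vec m) \<and>
    (\<forall>i<m. \<forall>j<m. u' i \<bullet> u' j = (if i = j then 1 else 0))"
    using step.prems y yy uy yu by (intro step.IH) (auto simp: less_Suc_eq)
  then show ?case by (metis fun_upd_other less_Suc_eq less_irrefl)
qed

section \<open>Compactness of the sphere and maximisation of a quotient of quadratic forms\<close>

lemma continuous_on_coordinate: "continuous_on S (\<lambda>f :: 'a \<Rightarrow> 'b :: topological_space. f i)"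
  by (rule continuous_on_subset[OF continuous_on_product_coordinates]) simp

text \<open>The Euclidean unit sphere is encoded by functions so that the product topology applies.
  It is closed in the cube of all functions into [-1,1], which is compact by Tychonoff. Fixing the
  coordinates from n on to 0 keeps the set inside the cube.\<close>

lemma compact_coordinate_sphere:
  "compact {f :: nat \<Rightarrow> real. (\<forall>i\<ge>n. f i = 0) \<and> (\<Sum>i<n. (f i)\<^sup>2) = 1}" (is "compact ?S")
proof -
  have "compact (PiE UNIV (\<lambda>_ :: nat. {-1..1 :: real}))"
    using compactin_PiE[of "\<lambda>_ :: nat. euclidean :: real topology" UNIV "\<lambda>_. {-1..1}"]
    by (simp add: euclidean_product_topology)
  moreover have "closed ?S"
  proof -
    have "closed {f :: nat \<Rightarrow> real. \<forall>i\<ge>n. f i = 0}"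
      by (intro closed_Collect_all closed_Collect_imp closed_Collect_eq open_Collect_const)
         (auto intro!: continuous_intros)
    moreover have "closed {f :: nat \<Rightarrow> real. (\<Sum>i<n. (f i)\<^sup>2) = 1}"
      by (intro closed_Collect_eq continuous_intros continuous_on_coordinate)
    ultimately show ?thesis by (simp add: Collect_conj_eq closed_Int)
  qed
  moreover have "?S \<subseteq> PiE UNIV (\<lambda>_ :: nat. {-1..1 :: real})"
  proof (intro subsetI PiE_I)
    fix f :: "nat \<Rightarrow> real" and i
    assume "f \<in> ?S"
    then have f: "\<forall>i\<ge>n. f i = 0" "(\<Sum>i<n. (f i)\<^sup>2) = 1" by auto
    have "(f i)\<^sup>2 \<le> 1"
    proof (cases "i < n")
      case True
      then have "(f i)\<^sup>2 \<le> (\<Sum>i<n. (f i)\<^sup>2)" by (intro member_le_sum) auto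
      with f show ?thesis by simp
    qed (use f in auto)
    then show "f i \<in> {-1..1}" by (auto simp: abs_square_le_1 abs_le_iff)
  qed simp
  ultimately show ?thesis using compact_Int_closed[of "PiE UNIV (\<lambda>_. {-1..1})" ?S] by (simp add: Int_absorb1)
qed

lemma continuous_on_mult_mat_vec_index:
  assumes "A \<in> carrier_mat m n" "i < m"
  shows "continuous_on S (\<lambda>f :: nat \<Rightarrow> real. (A *\<^sub>v vec n f) $ i)"
  using assms by (auto simp: scalar_prod_def intro!: continuous_intros continuous_on_coordinate)

text \<open>Maximising the quotient over the Euclidean unit sphere, instead of \<open>|A x|^2\<close> over the \<open>M\<close>-unit
  sphere, makes compactness independent of \<open>M\<close>.\<close>
lemma exists_max_quotient:
  fixes w :: "nat \<Rightarrow> real vec"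
  assumes A: "A \<in> carrier_mat m n" and M: "sym_pos_def n M"
    and w: "\<And>l. l < k \<Longrightarrow> w l \<in> carrier_vec n" and "k < n"
  obtains v where "v \<in> carrier_vec n" "v \<bullet> (M *\<^sub>v v) = 1" "\<And>l. l < k \<Longrightarrow> w l \<bullet> v = 0"
    "\<And>x. x \<in> carrier_vec n \<Longrightarrow> (\<And>l. l < k \<Longrightarrow> w l \<bullet> x = 0) \<Longrightarrow>
      (A *\<^sub>v x) \<bullet> (A *\<^sub>v x) \<le> (A *\<^sub>v v) \<bullet> (A *\<^sub>v v) * (x \<bullet> (M *\<^sub>v x))"
proof -
  define q where "q x = (A *\<^sub>v x) \<bullet> (A *\<^sub>v x)" for x
  define p where "p x = x \<bullet> (M *\<^sub>v x)" for x
  have Mc: "M \<in> carrier_mat n n" and p_pos: "\<And>x. x \<in> carrier_vec n \<Longrightarrow> x \<noteq> 0\<^sub>v n \<Longrightarrow> p x > 0"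
    using M by (auto simp: sym_pos_def_def p_def)
  have q_smult: "q (c \<cdot>\<^sub>v x) = c\<^sup>2 * q x" if "x \<in> carrier_vec n" for c x
    using that A by (simp add: q_def mult_mat_vec power2_eq_square)
  have p_smult: "p (c \<cdot>\<^sub>v x) = c\<^sup>2 * p x" if "x \<in> carrier_vec n" for c x
    using that Mc by (simp add: p_def mult_mat_vec power2_eq_square)
  define S where "S = {f :: nat \<Rightarrow> real. (\<forall>i\<ge>n. f i = 0) \<and> (\<Sum>i<n. (f i)\<^sup>2) = 1}"
  \<comment> \<open>The points of the sphere that satisfy the orthogonality constraints; the
    quotient \<open>q / p\<close> is maximised over this set.\<close>
  define K where "K = S \<inter> {f. \<forall>l\<in>{..<k}. w l \<bullet> vec n f = 0}"
  have nz: "vec n f \<noteq> 0\<^sub>v n" if "f \<in> S" for f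
  proof
    assume "vec n f = 0\<^sub>v n"
    then have "f i = 0" if "i < n" for i using that by (metis index_vec index_zero_vec(1))
    with \<open>f \<in> S\<close> show False by (simp add: S_def)
  qed
  have normalize: "\<exists>f\<in>K. \<exists>c>0. vec n f = c \<cdot>\<^sub>v x"
    if x: "x \<in> carrier_vec n" "x \<noteq> 0\<^sub>v n" "\<And>l. l < k \<Longrightarrow> w l \<bullet> x = 0" for x
  proof -
    define c where "c = 1 / sqrt (x \<bullet> x)"
    have xx: "x \<bullet> x > 0" using scalar_prod_self_pos x by blast
    define f where "f i = (if i < n then c * x $ i else 0)" for i
    have f: "vec n f = c \<cdot>\<^sub>v x" using x(1) by (intro eq_vecI) (auto simp: f_def)
    have "(\<Sum>i<n. (f i)\<^sup>2) = c\<^sup>2 * (x \<bullet> x)"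
      using x(1) by (simp add: f_def scalar_prod_def sum_distrib_left atLeast0LessThan power2_eq_square mult_ac)
    also have "\<dots> = 1" using xx by (simp add: c_def power_divide)
    finally have "f \<in> S" by (simp add: S_def f_def)
    moreover have "w l \<bullet> vec n f = 0" if "l < k" for l using that x w by (auto simp: f)
    ultimately have "f \<in> K" by (simp add: K_def)
    moreover have "c > 0" using xx by (simp add: c_def)
    ultimately show ?thesis using f by (intro bexI[of _ f] exI[of _ c] conjI)
  qed
  \<comment> \<open>The assumption k < n leaves room for an admissible nonzero vector, so that
    \<open>K\<close> is nonempty.\<close>
  obtain x0 where "x0 \<in> carrier_vec n" "x0 \<noteq> 0\<^sub>v n" "\<And>l. l < k \<Longrightarrow> w l \<bullet> x0 = 0"
    using exists_nonzero_orthogonal_vec[of k w n] w \<open>k < n\<close> by auto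
  then have "K \<noteq> {}" using normalize by blast
  moreover have "compact K"
  proof -
    have "closed {f. w l \<bullet> vec n f = 0}" if "l < k" for l
      by (intro closed_Collect_eq)
         (auto simp: scalar_prod_def intro!: continuous_intros continuous_on_coordinate)
    then have "closed {f. \<forall>l\<in>{..<k}. w l \<bullet> vec n f = 0}"
      by (simp add: Collect_ball_eq closed_INT)
    then show ?thesis unfolding K_def S_def using compact_coordinate_sphere compact_Int_closed by blast
  qed
  moreover have "continuous_on K (\<lambda>f. q (vec n f) / p (vec n f))"
  proof (intro continuous_on_divide ballI)
    have q: "q (vec n f) = (\<Sum>i<m. ((A *\<^sub>v vec n f) $ i)\<^sup>2)" for f
      unfolding q_def scalar_prod_def using A by (simp add: power2_eq_square atLeast0LessThan)
    show "continuous_on K (\<lambda>f. q (vec n f))"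
      unfolding q by (intro continuous_intros continuous_on_mult_mat_vec_index[OF A]) auto
    have p: "p (vec n f) = (\<Sum>i<n. f i * (M *\<^sub>v vec n f) $ i)" for f
      unfolding p_def scalar_prod_def using Mc by (simp add: atLeast0LessThan)
    show "continuous_on K (\<lambda>f. p (vec n f))"
      unfolding p by (intro continuous_intros continuous_on_mult_mat_vec_index[OF Mc]
        continuous_on_coordinate) auto
    fix f assume "f \<in> K"
    then have "p (vec n f) > 0" using nz by (intro p_pos) (auto simp: K_def)
    then show "p (vec n f) \<noteq> 0" by simp
  qed
  ultimately obtain g where g: "g \<in> K"
      "\<And>f. f \<in> K \<Longrightarrow> q (vec n f) / p (vec n f) \<le> q (vec n g) / p (vec n g)"
    using continuous_attains_sup[of K "\<lambda>f. q (vec n f) / p (vec n f)"] by blast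
  define y where "y = vec n g"
  have y: "y \<in> carrier_vec n" "\<And>l. l < k \<Longrightarrow> w l \<bullet> y = 0" "p y > 0"
    using g(1) by (auto simp: y_def K_def intro!: p_pos nz)
  \<comment> \<open>Rescaling the maximiser to \<open>p v = 1\<close> turns \<open>q v\<close> into
    the maximal quotient.\<close>
  define v where "v = (1 / sqrt (p y)) \<cdot>\<^sub>v y"
  have v: "v \<in> carrier_vec n" "\<And>l. l < k \<Longrightarrow> w l \<bullet> v = 0" using y w by (auto simp: v_def)
  have pv: "p v = 1" and qv: "q v = q y / p y"
    using y by (simp_all add: v_def p_smult q_smult power_divide)
  have "q x \<le> q v * p x" if x: "x \<in> carrier_vec n" "\<And>l. l < k \<Longrightarrow> w l \<bullet> x = 0" for x
  proof (cases "x = 0\<^sub>v n")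
    case True
    \<comment> \<open>The zero vector has no representative on the sphere; homogeneity with factor 0
      makes both sides of the bound vanish.\<close>
    then have "x = 0 \<cdot>\<^sub>v x" by auto
    then have "q x = 0" "p x = 0" using q_smult[OF x(1), of 0] p_smult[OF x(1), of 0] by auto
    then show ?thesis by simp
  next
    case False
    obtain f c where f: "f \<in> K" "c > 0" "vec n f = c \<cdot>\<^sub>v x" using normalize[OF x(1) False x(2)] by blast
    have "q x / p x = q (vec n f) / p (vec n f)"
      using f x by (simp add: p_smult q_smult)
    also have "\<dots> \<le> q v" using g(2)[OF f(1)] by (simp add: qv y_def)
    finally show ?thesis using p_pos[OF x(1) False] by (simp add: divide_le_eq)
  qed
  then show ?thesis using that v pv unfolding p_def q_def by blast
qed

section \<open>Greedy construction of the M-orthonormal family\<close>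

text \<open>Maximality is stated in homogeneous form, free of division and of normalisation of
  \<open>x\<close>, so that it can be tested directly on combinations of family members.\<close>

definition greedy_vec :: "nat \<Rightarrow> real mat \<Rightarrow> real mat \<Rightarrow> (nat \<Rightarrow> real vec) \<Rightarrow> nat \<Rightarrow> bool" where
  "greedy_vec n M A v i \<longleftrightarrow> v i \<in> carrier_vec n \<and> v i \<bullet> (M *\<^sub>v v i) = 1 \<and>
    (\<forall>l<i. (M *\<^sub>v v l) \<bullet> v i = 0) \<and>
    (\<forall>x\<in>carrier_vec n. (\<forall>l<i. (M *\<^sub>v v l) \<bullet> x = 0) \<longrightarrow>
      (A *\<^sub>v x) \<bullet> (A *\<^sub>v x) \<le> (A *\<^sub>v v i) \<bullet> (A *\<^sub>v v i) * (x \<bullet> (M *\<^sub>v x)))"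

lemma greedy_vec_cong: "(\<And>l. l \<le> i \<Longrightarrow> v l = v' l) \<Longrightarrow> greedy_vec n M A v i = greedy_vec n M A v' i"
  by (simp add: greedy_vec_def)

text \<open>Each new vector comes from \<open>exists_max_quotient\<close> with the constraint
  vectors \<open>M *\<^sub>v v l\<close>, which express M-orthogonality to the vectors already
  chosen.\<close>

lemma greedy_family:
  assumes A: "A \<in> carrier_mat m n" and M: "sym_pos_def n M"
  shows "k \<le> n \<Longrightarrow> \<exists>v. \<forall>i<k. greedy_vec n M A v i"
proof (induction k)
  case (Suc k)
  then obtain v where v: "\<And>i. i < k \<Longrightarrow> greedy_vec n M A v i" by auto
  have "M *\<^sub>v v l \<in> carrier_vec n" if "l < k" for l
    using v[OF that] M unfolding greedy_vec_def sym_pos_def_def by (metis mult_mat_vec_carrier)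
  then obtain y where y: "y \<in> carrier_vec n" "y \<bullet> (M *\<^sub>v y) = 1"
    "\<And>l. l < k \<Longrightarrow> (M *\<^sub>v v l) \<bullet> y = 0"
    "\<And>x. x \<in> carrier_vec n \<Longrightarrow> (\<And>l. l < k \<Longrightarrow> (M *\<^sub>v v l) \<bullet> x = 0) \<Longrightarrow>
      (A *\<^sub>v x) \<bullet> (A *\<^sub>v x) \<le> (A *\<^sub>v y) \<bullet> (A *\<^sub>v y) * (x \<bullet> (M *\<^sub>v x))"
    using exists_max_quotient[OF A M, of k "\<lambda>l. M *\<^sub>v v l"] Suc.prems by (metis Suc_le_lessD)
  have "greedy_vec n M A (v(k := y)) k"
    using y by (simp add: greedy_vec_def)
  \<comment> \<open>The condition at i only looks at indices up to i, so changing the value at k > i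
    preserves it.\<close>
  moreover have "greedy_vec n M A (v(k := y)) i" if "i < k" for i
    using v[OF that] greedy_vec_cong[of i "v(k := y)" v] that by simp
  ultimately show ?case by (metis less_Suc_eq)
qed simp

text \<open>For small t of the same sign as \<open>a\<close> the linear term outgrows the quadratic
  one. This turns a maximality inequality along a line into vanishing of the first
  variation.\<close>

lemma linear_coeff_zero:
  fixes a b :: real
  assumes "\<And>t. t * a \<le> t\<^sup>2 * b"
  shows "a = 0"
proof (rule ccontr)
  assume "a \<noteq> 0"
  \<comment> \<open>With t = a / c the assumption reads a^2 / c \<le> a^2 b / c^2, which contradicts
    b < c; the summand 1 makes \<open>c\<close> positive.\<close>
  define c where "c = \<bar>b\<bar> + 1"
  have c: "c > 0" "b < c" by (auto simp: c_def)
  have "a / c * a \<le> (a / c)\<^sup>2 * b" by (rule assms)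
  also have "\<dots> < (a / c)\<^sup>2 * c" using c \<open>a \<noteq> 0\<close> by (intro mult_strict_left_mono) auto
  also have "\<dots> = a / c * a" using c by (simp add: power2_eq_square)
  finally show False by simp
qed

text \<open>The \<open>v i\<close> are to become the columns of V, and their nonzero images under
  \<open>A\<close>, once normalised, the leading columns of U.\<close>

lemma M_orthogonal_singular_family:
  assumes A: "A \<in> carrier_mat m n" and M: "sym_pos_def n M"
  obtains v where "\<And>i. i < n \<Longrightarrow> v i \<in> carrier_vec n"
    "\<And>i j. i < n \<Longrightarrow> j < n \<Longrightarrow> v i \<bullet> (M *\<^sub>v v j) = (if i = j then 1 else 0)"
    "\<And>i j. i < n \<Longrightarrow> j < n \<Longrightarrow> i \<noteq> j \<Longrightarrow> (A *\<^sub>v v i) \<bullet> (A *\<^sub>v v j) = 0"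
    "\<And>i j. i \<le> j \<Longrightarrow> j < n \<Longrightarrow> (A *\<^sub>v v j) \<bullet> (A *\<^sub>v v j) \<le> (A *\<^sub>v v i) \<bullet> (A *\<^sub>v v i)"
proof -
  have Mc: "M \<in> carrier_mat n n" and Mt: "transpose_mat M = M" using M by (auto simp: sym_pos_def_def)
  have M_sym: "(M *\<^sub>v x) \<bullet> y = x \<bullet> (M *\<^sub>v y)" if "x \<in> carrier_vec n" "y \<in> carrier_vec n" for x y
    using transpose_vec_mult_scalar[OF Mc that(2,1)] Mt by simp
  obtain v where "\<forall>i<n. greedy_vec n M A v i"
    using greedy_family[OF A M, of n] by auto
  then have v: "\<And>i. i < n \<Longrightarrow> v i \<in> carrier_vec n" "\<And>i. i < n \<Longrightarrow> v i \<bullet> (M *\<^sub>v v i) = 1"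
    and vl: "\<And>l i. l < i \<Longrightarrow> i < n \<Longrightarrow> (M *\<^sub>v v l) \<bullet> v i = 0"
    and vmax: "\<And>i x. i < n \<Longrightarrow> x \<in> carrier_vec n \<Longrightarrow> (\<And>l. l < i \<Longrightarrow> (M *\<^sub>v v l) \<bullet> x = 0) \<Longrightarrow>
      (A *\<^sub>v x) \<bullet> (A *\<^sub>v x) \<le> (A *\<^sub>v v i) \<bullet> (A *\<^sub>v v i) * (x \<bullet> (M *\<^sub>v x))"
    unfolding greedy_vec_def by blast+
  have Mv[simp]: "M *\<^sub>v v i \<in> carrier_vec n" if "i < n" for i using v(1)[OF that] Mc by simp
  have Av[simp]: "A *\<^sub>v v i \<in> carrier_vec m" if "i < n" for i using v(1)[OF that] A by simp
  have vv: "v i \<bullet> (M *\<^sub>v v j) = (if i = j then 1 else 0)" if "i < n" "j < n" for i j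
  proof (cases i j rule: linorder_cases)
    case less
    then show ?thesis using vl[of i j] M_sym[of "v i" "v j"] v that by simp
  next
    case greater
    then show ?thesis using vl[of j i] comm_scalar_prod[of "v i" n "M *\<^sub>v v j"] v that by simp
  qed (use v that in simp)
  \<comment> \<open>For i \<le> j the vector \<open>v j\<close> already satisfies the constraints of
    stage i and has M-norm 1, so it competes with \<open>v i\<close>.\<close>
  have mono: "(A *\<^sub>v v j) \<bullet> (A *\<^sub>v v j) \<le> (A *\<^sub>v v i) \<bullet> (A *\<^sub>v v i)" if "i \<le> j" "j < n" for i j
    using vmax[of i "v j"] vl[of _ j] v that by auto
  have orth: "(A *\<^sub>v v i) \<bullet> (A *\<^sub>v v j) = 0" if ij: "i < j" "j < n" for i j
  proof -
    have i: "i < n" using ij by simp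
    \<comment> \<open>The competitor at stage i is \<open>v i + t \<cdot>\<^sub>v v j\<close>, whose
      squared M-norm is 1 + t^2. Expanding the maximality bound, the terms constant in t cancel and
      exactly this inequality remains.\<close>
    have "t * (2 * ((A *\<^sub>v v i) \<bullet> (A *\<^sub>v v j))) \<le>
        t\<^sup>2 * ((A *\<^sub>v v i) \<bullet> (A *\<^sub>v v i) - (A *\<^sub>v v j) \<bullet> (A *\<^sub>v v j))" for t
    proof -
      define x where "x = v i + t \<cdot>\<^sub>v v j"
      have x: "x \<in> carrier_vec n" using v i ij by (simp add: x_def)
      have "(M *\<^sub>v v l) \<bullet> x = 0" if "l < i" for l
        using that v i ij vl[of l i] vl[of l j]
          by (simp add: x_def scalar_prod_add_distrib[of _ n] scalar_prod_smult_distrib[of _ n])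
      from vmax[OF i x this]
      have le: "(A *\<^sub>v x) \<bullet> (A *\<^sub>v x) \<le> (A *\<^sub>v v i) \<bullet> (A *\<^sub>v v i) * (x \<bullet> (M *\<^sub>v x))" .
      have Ax: "A *\<^sub>v x = A *\<^sub>v v i + t \<cdot>\<^sub>v (A *\<^sub>v v j)"
        using v i ij A by (simp add: x_def mult_add_distrib_mat_vec[OF A] mult_mat_vec[OF A])
      have Mx: "M *\<^sub>v x = M *\<^sub>v v i + t \<cdot>\<^sub>v (M *\<^sub>v v j)"
        using v i ij Mc by (simp add: x_def mult_add_distrib_mat_vec[OF Mc] mult_mat_vec[OF Mc])
      have "(A *\<^sub>v x) \<bullet> (A *\<^sub>v x) = (A *\<^sub>v v i) \<bullet> (A *\<^sub>v v i) + 2 * t * ((A *\<^sub>v v i) \<bullet> (A *\<^sub>v v j))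
          + t\<^sup>2 * ((A *\<^sub>v v j) \<bullet> (A *\<^sub>v v j))"
        unfolding Ax using i ij comm_scalar_prod[OF Av[OF ij(2)] Av[OF i]]
        by (simp add: scalar_prod_add_distrib[of _ m] add_scalar_prod_distrib[of _ m]
          smult_scalar_prod_distrib[of _ m] scalar_prod_smult_distrib[of _ m] power2_eq_square algebra_simps)
      moreover have "x \<bullet> (M *\<^sub>v x) = 1 + t\<^sup>2"
        unfolding Mx unfolding x_def using i ij v vv
        by (simp add: scalar_prod_add_distrib[of _ n] add_scalar_prod_distrib[of _ n]
          smult_scalar_prod_distrib[of _ n] scalar_prod_smult_distrib[of _ n] power2_eq_square)
      ultimately show ?thesis using le by (simp add: algebra_simps)
    qed
    from linear_coeff_zero[OF this] show ?thesis by simp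
  qed
  have "(A *\<^sub>v v i) \<bullet> (A *\<^sub>v v j) = 0" if "i < n" "j < n" "i \<noteq> j" for i j
    using orth[of i j] orth[of j i] that comm_scalar_prod[OF Av Av, of i j] by (metis linorder_neqE_nat)
  with v(1) vv mono show ?thesis using that[of v] by blast
qed

section \<open>Assembly of the weighted singular value decomposition\<close>

theorem theorem3p1:
  fixes A M :: "real mat" and m n :: nat
  assumes "A \<in> carrier_mat m n"
    and "sym_pos_def n M"
  shows "\<exists>U V r. \<exists>\<sigma> :: nat \<Rightarrow> real.
    two_orthogonal m U \<and> M_orthogonal n M V \<and> r \<le> m \<and> r \<le> n \<and>
    (\<forall>i j. i \<le> j \<and> j < r \<longrightarrow> \<sigma> i \<ge> \<sigma> j) \<and> (\<forall>i<r. \<sigma> i > 0) \<and>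
    transpose_mat U * A * V =
      four_block_mat (mat_diag r \<sigma>) (0\<^sub>m r (n - r))
                     (0\<^sub>m (m - r) r) (0\<^sub>m (m - r) (n - r))"
proof -
  note A = assms(1)
  have M: "M \<in> carrier_mat n n" using assms(2) by (simp add: sym_pos_def_def)
  obtain v where v: "\<And>i. i < n \<Longrightarrow> v i \<in> carrier_vec n"
    "\<And>i j. i < n \<Longrightarrow> j < n \<Longrightarrow> v i \<bullet> (M *\<^sub>v v j) = (if i = j then 1 else 0)"
    and orth: "\<And>i j. i < n \<Longrightarrow> j < n \<Longrightarrow> i \<noteq> j \<Longrightarrow> (A *\<^sub>v v i) \<bullet> (A *\<^sub>v v j) = 0"
    and mono: "\<And>i j. i \<le> j \<Longrightarrow> j < n \<Longrightarrow> (A *\<^sub>v v j) \<bullet> (A *\<^sub>v v j) \<le> (A *\<^sub>v v i) \<bullet> (A *\<^sub>v v i)"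
    using M_orthogonal_singular_family[OF assms] by blast
  have Av: "A *\<^sub>v v i \<in> carrier_vec m" if "i < n" for i using v(1)[OF that] A by simp
  \<comment> \<open>The number of nonzero singular values: the first index with zero image. The
    disjunct \<open>i = n\<close> makes the least index exist when no image vanishes.\<close>
  define r where "r = (LEAST i. i = n \<or> A *\<^sub>v v i = 0\<^sub>v m)"
  define \<sigma> where "\<sigma> i = sqrt ((A *\<^sub>v v i) \<bullet> (A *\<^sub>v v i))" for i
  have rn: "r \<le> n" unfolding r_def by (rule Least_le) simp
  have r: "r = n \<or> A *\<^sub>v v r = 0\<^sub>v m" unfolding r_def by (rule LeastI[of _ n]) simp
  have pos: "(A *\<^sub>v v i) \<bullet> (A *\<^sub>v v i) > 0" if "i < r" for i
    using not_less_Least[of i "\<lambda>i. i = n \<or> A *\<^sub>v v i = 0\<^sub>v m"] that rn Av[of i]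
    by (intro scalar_prod_self_pos[of _ m]) (auto simp: r_def)
  \<comment> \<open>The norms decrease, so after the first zero image all later ones vanish
    too.\<close>
  have zero: "A *\<^sub>v v i = 0\<^sub>v m" if "r \<le> i" "i < n" for i
    using mono[OF that] r that scalar_prod_self_pos[OF Av[OF that(2)]] by force
  \<comment> \<open>The left singular vectors; only indices below r matter, where the divisor
    \<open>\<sigma> i\<close> is positive.\<close>
  define u where "u i = (1 / \<sigma> i) \<cdot>\<^sub>v (A *\<^sub>v v i)" for i
  have \<sigma>: "\<sigma> i > 0" "\<sigma> i * \<sigma> i = (A *\<^sub>v v i) \<bullet> (A *\<^sub>v v i)" if "i < r" for i
    using pos[OF that] by (auto simp: \<sigma>_def)
  have u: "u i \<in> carrier_vec m" if "i < r" for i using Av that rn by (simp add: u_def)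
  have Av_u: "A *\<^sub>v v i = \<sigma> i \<cdot>\<^sub>v u i" if "i < r" for i
    using \<sigma>(1)[OF that] by (simp add: u_def smult_smult_assoc)
  have uu: "u i \<bullet> u j = (if i = j then 1 else 0)" if "i < r" "j < r" for i j
    using that rn orth[of i j] Av[of i] Av[of j] \<sigma>(1)[of i] \<sigma>(2)[of i]
    by (auto simp: u_def smult_scalar_prod_distrib[of _ m] scalar_prod_smult_distrib[of _ m])
  \<comment> \<open>The bound is needed to complete the family in dimension m and keeps the
    truncated subtraction \<open>m - r\<close> in the block sizes exact.\<close>
  have rm: "r \<le> m" using orthonormal_family_le_dim[of r u m] u uu by blast
  obtain u' where u'u: "\<And>i. i < r \<Longrightarrow> u' i = u i" and u': "\<And>i. i < m \<Longrightarrow> u' i \<in> carrier_vec m"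
    "\<And>i j. i < m \<Longrightarrow> j < m \<Longrightarrow> u' i \<bullet> u' j = (if i = j then 1 else 0)"
    using orthonormal_family_extend[OF rm u uu] by blast
  define U where "U = mat_of_cols m (map u' [0..<m])"
  define V where "V = mat_of_cols n (map v [0..<n])"
  have U: "U \<in> carrier_mat m m" and V: "V \<in> carrier_mat n n"
    using mat_of_cols_carrier(1)[of m "map u' [0..<m]"] mat_of_cols_carrier(1)[of n "map v [0..<n]"]
    by (simp_all add: U_def V_def)
  have colU: "col U i = u' i" if "i < m" for i using that u' by (simp add: U_def)
  have colV: "col V i = v i" if "i < n" for i using that v by (simp add: V_def)
  have "two_orthogonal m U"
    unfolding two_orthogonal_def using U u' by (auto intro!: eq_matI simp: colU)
  moreover have "M_orthogonal n M V"
  proof -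
    have "transpose_mat V * M * V = transpose_mat V * (M * V)" using V M by simp
    also have "\<dots> = 1\<^sub>m n"
      using V M v by (auto intro!: eq_matI simp: colV col_mult2[OF M V])
    finally show ?thesis using V by (simp add: M_orthogonal_def)
  qed
  moreover have "\<forall>i j. i \<le> j \<and> j < r \<longrightarrow> \<sigma> i \<ge> \<sigma> j"
    using mono rn by (auto simp: \<sigma>_def)
  moreover have "transpose_mat U * A * V =
      four_block_mat (mat_diag r \<sigma>) (0\<^sub>m r (n - r)) (0\<^sub>m (m - r) r) (0\<^sub>m (m - r) (n - r))"
  proof -
    \<comment> \<open>For j < r the image of \<open>v j\<close> is \<open>\<sigma> j\<close> times
      \<open>u' j\<close>, since the completion keeps the first r vectors; orthonormality then
      leaves only the diagonal. For j \<ge> r the image is zero.\<close>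
    have entry: "u' i \<bullet> (A *\<^sub>v v j) = (if i = j \<and> j < r then \<sigma> j else 0)" if ij: "i < m" "j < n" for i j
    proof (cases "j < r")
      case True
      then have "u' i \<bullet> (A *\<^sub>v v j) = \<sigma> j * (u' i \<bullet> u' j)"
        using ij rm u'(1)[of i] u by (simp add: Av_u u'u scalar_prod_smult_distrib[of _ m])
      then show ?thesis using True ij rm u'(2) by simp
    qed (use ij zero u' in auto)
    have "transpose_mat U * A * V = transpose_mat U * (A * V)" using U A V by simp
    also have "\<dots> = mat m n (\<lambda>(i, j). u' i \<bullet> (A *\<^sub>v v j))"
      using U A V by (auto intro!: eq_matI simp: colU colV col_mult2[OF A V])
    also have "\<dots> = four_block_mat (mat_diag r \<sigma>) (0\<^sub>m r (n - r)) (0\<^sub>m (m - r) r) (0\<^sub>m (m - r) (n - r))"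
      using rm rn by (intro eq_matI) (auto simp: entry mat_diag_def)
    finally show ?thesis .
  qed
  ultimately show ?thesis using rm rn \<sigma>(1) by blast
qed

end
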